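(* Let $d\ge 1$, $\alpha<1$, let $\mathbf F:S^{d-1}\to\mathbb R^d$ be continuously differentiable, and let $\mathbf x(t)$ be the solution of $\dot{\mathbf x}=|\mathbf x|^\alpha\,\mathbf F(\mathbf x/|\mathbf x|)$, $\mathbf x(t_0)=\mathbf x_0\ne\mathbf 0$, on its maximal interval $[t_0,t_b)$ on which $\mathbf x(t)\neq \mathbf 0$. Write $r(t)=|\mathbf x(t)|$, $\mathbf y(t)=\mathbf x(t)/r(t)$, $\mathbf y_0=\mathbf x_0/|\mathbf x_0|$. Let $\mathcal A\subset S^{d-1}$ be an attractor of the system $d\tilde{\mathbf y}/ds=\mathbf F_s(\tilde{\mathbf y})$ on $S^{d-1}$, with basin of attraction $\mathcal B(\mathcal A)$. (i) If $\mathcal A$ is defocusing and $\mathbf y_0\in\mathcal B(\mathcal A)$, then $t_b=\infty$ and $\lim_{t\to\infty}r(t)=\infty$. (ii) If $\mathcal A$ is focusing and $\mathbf y_0\in\mathcal B(\mathcal A)$, then the solution $\mathbf x(t)$ blows up in finite time, i.e. $t_b<\infty$ and $\lim_{t\to t_b}r(t)=0$, and moreover $\lim_{t\to t_b}\mathrm{dist}(\mathbf y(t),\mathcal A)=0$.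
   Context: Decompose $\mathbf F(\mathbf y)=F_r(\mathbf y)\,\mathbf y+\mathbf F_s(\mathbf y)$ with $F_r(\mathbf y)=\mathbf F(\mathbf y)\cdot\mathbf y$, so that $\mathbf F_s$ is a $C^1$ tangent vector field on $S^{d-1}$. The time $t_b\in(t_0,\infty]$ is the maximal time such that $r(t)\ne0$ for $t\in[t_0,t_b)$; on this interval the solution is unique. The renormalized system is $d\tilde{\mathbf y}/ds=\mathbf F_s(\tilde{\mathbf y})$ on $S^{d-1}$ (with globally defined flow). An attractor is a nonempty compact invariant set $\mathcal A\subset S^{d-1}$ that has a neighborhood $U_0$ with $\bigcap_{s\ge0}U_s=\mathcal A$, where $U_s$ is the image of $U_0$ under the time-$s$ flow. Its basin of attraction $\mathcal B(\mathcal A)$ is the set of all points whose trajectories approach $\mathcal A$ asymptotically as $s\to\infty$. For a solution $\tilde{\mathbf y}(s)$ of the renormalized system with $\tilde{\mathbf y}(0)=\mathbf y_0$ set $$\underline{F_r}=\liminf_{s\to\infty}\frac1s\int_0^sF_r(\tilde{\mathbf y}(s'))\,ds',\qquad \overline{F_r}=\limsup_{s\to\infty}\frac1s\int_0^sF_r(\tilde{\mathbf y}(s'))\,ds'.$$ The attractor $\mathcal A$ is focusing if $\overline{F_r}<0$ for every $\mathbf y_0\in\mathcal B(\mathcal A)$, and defocusing if $\underline{F_r}>0$ for every $\mathbf y_0\in\mathcal B(\mathcal A)$. *)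

theory Defs
  imports "HOL-Analysis.Analysis"
begin

text \<open>Euclidean \<open>d\<close>-space is a type \<open>'a :: euclidean_space\<close> with \<open>d = DIM('a)\<close> (hence \<open>d \<ge> 1\<close>), and
  the sphere is \<open>sphere 0 1\<close>. A field \<open>F\<close> on the sphere is a total function of which only the values
  on the sphere matter.\<close>

text \<open>A map on the sphere, as a submanifold of Euclidean space, is of class \<open>C\<^sup>1\<close> if it is the
  restriction of a \<open>C\<^sup>1\<close> map defined on an open neighbourhood of the sphere.\<close>

definition C1_on_sphere :: "('a::euclidean_space \<Rightarrow> 'a) \<Rightarrow> bool" where
  "C1_on_sphere F \<longleftrightarrow>
     (\<exists>U G (G' :: 'a \<Rightarrow> 'a \<Rightarrow>\<^sub>L 'a).
        open U \<and> sphere 0 1 \<subseteq> U \<and> (\<forall>p\<in>sphere 0 1. G p = F p) \<and>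
        (\<forall>p\<in>U. (G has_derivative blinfun_apply (G' p)) (at p)) \<and> continuous_on U G')"

definition radial_part :: "('a::euclidean_space \<Rightarrow> 'a) \<Rightarrow> 'a \<Rightarrow> real" where
  "radial_part F p = F p \<bullet> p"

definition spherical_part :: "('a::euclidean_space \<Rightarrow> 'a) \<Rightarrow> 'a \<Rightarrow> 'a" where
  "spherical_part F p = F p - radial_part F p *\<^sub>R p"

text \<open>For \<open>F\<close> of class \<open>C\<^sup>1\<close> exactly one trajectory starts at each point of the sphere, so the
  time-\<open>s\<close> flow sends \<open>p\<close> to \<open>y s\<close> for the trajectory \<open>y\<close> with \<open>y 0 = p\<close>.\<close>

definition renorm_trajectory :: "('a::euclidean_space \<Rightarrow> 'a) \<Rightarrow> (real \<Rightarrow> 'a) \<Rightarrow> bool" where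
  "renorm_trajectory F y \<longleftrightarrow>
     (\<forall>s. y s \<in> sphere 0 1 \<and> (y has_vector_derivative spherical_part F (y s)) (at s))"

definition flow_image :: "('a::euclidean_space \<Rightarrow> 'a) \<Rightarrow> real \<Rightarrow> 'a set \<Rightarrow> 'a set" where
  "flow_image F s U = {y s | y. renorm_trajectory F y \<and> y 0 \<in> U}"

definition attractor :: "('a::euclidean_space \<Rightarrow> 'a) \<Rightarrow> 'a set \<Rightarrow> bool" where
  "attractor F A \<longleftrightarrow>
     A \<noteq> {} \<and> compact A \<and> A \<subseteq> sphere 0 1 \<and> (\<forall>s. flow_image F s A = A) \<and>
     (\<exists>U V. openin (top_of_set (sphere 0 1)) V \<and> A \<subseteq> V \<and> V \<subseteq> U \<and> U \<subseteq> sphere 0 1 \<and>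
        (\<Inter>s\<in>{0..}. flow_image F s U) = A)"

definition basin :: "('a::euclidean_space \<Rightarrow> 'a) \<Rightarrow> 'a set \<Rightarrow> 'a set" where
  "basin F A = {y 0 | y. renorm_trajectory F y \<and> ((\<lambda>s. infdist (y s) A) \<longlongrightarrow> 0) at_top}"

definition radial_mean :: "('a::euclidean_space \<Rightarrow> 'a) \<Rightarrow> (real \<Rightarrow> 'a) \<Rightarrow> real \<Rightarrow> real" where
  "radial_mean F y s = (1 / s) * integral {0..s} (\<lambda>s'. radial_part F (y s'))"

definition lower_radial_mean :: "('a::euclidean_space \<Rightarrow> 'a) \<Rightarrow> (real \<Rightarrow> 'a) \<Rightarrow> ereal" where
  "lower_radial_mean F y = Liminf at_top (\<lambda>s. ereal (radial_mean F y s))"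

definition upper_radial_mean :: "('a::euclidean_space \<Rightarrow> 'a) \<Rightarrow> (real \<Rightarrow> 'a) \<Rightarrow> ereal" where
  "upper_radial_mean F y = Limsup at_top (\<lambda>s. ereal (radial_mean F y s))"

definition focusing :: "('a::euclidean_space \<Rightarrow> 'a) \<Rightarrow> 'a set \<Rightarrow> bool" where
  "focusing F A \<longleftrightarrow>
     (\<forall>y. renorm_trajectory F y \<and> y 0 \<in> basin F A \<longrightarrow> upper_radial_mean F y < 0)"

definition defocusing :: "('a::euclidean_space \<Rightarrow> 'a) \<Rightarrow> 'a set \<Rightarrow> bool" where
  "defocusing F A \<longleftrightarrow>
     (\<forall>y. renorm_trajectory F y \<and> y 0 \<in> basin F A \<longrightarrow> 0 < lower_radial_mean F y)"

definition nonvanishing_solution ::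
    "real \<Rightarrow> ('a::euclidean_space \<Rightarrow> 'a) \<Rightarrow> real \<Rightarrow> 'a \<Rightarrow> ereal \<Rightarrow> (real \<Rightarrow> 'a) \<Rightarrow> bool" where
  "nonvanishing_solution \<alpha> F t0 x0 tb x \<longleftrightarrow>
     ereal t0 < tb \<and> x t0 = x0 \<and>
     (\<forall>t. t0 \<le> t \<and> ereal t < tb \<longrightarrow>
        x t \<noteq> 0 \<and>
        (x has_vector_derivative (norm (x t) powr \<alpha>) *\<^sub>R F (x t /\<^sub>R norm (x t)))
          (at t within {u. t0 \<le> u \<and> ereal u < tb}))"

text \<open>Since \<open>\<alpha> < 1\<close> and \<open>F\<close> is bounded on the sphere, a solution cannot escape to infinity in finite
  time, so a nonvanishing solution that cannot be continued past a finite \<open>tb\<close> reaches the origin there.\<close>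

definition maximal_nonvanishing_solution ::
    "real \<Rightarrow> ('a::euclidean_space \<Rightarrow> 'a) \<Rightarrow> real \<Rightarrow> 'a \<Rightarrow> ereal \<Rightarrow> (real \<Rightarrow> 'a) \<Rightarrow> bool" where
  "maximal_nonvanishing_solution \<alpha> F t0 x0 tb x \<longleftrightarrow>
     nonvanishing_solution \<alpha> F t0 x0 tb x \<and>
     (\<forall>tb' x'. nonvanishing_solution \<alpha> F t0 x0 tb' x' \<and>
        (\<forall>t. t0 \<le> t \<and> ereal t < tb \<longrightarrow> x' t = x t) \<longrightarrow> tb' \<le> tb)"

end

theory Submission
  imports Defs
begin

text \<open>Let \<open>Y\<close> be the renormalized trajectory through \<open>x0 / |x0|\<close> and put \<open>I s = \<integral>\<^sub>0\<^sup>s F\<^sub>r (Y u) du\<close>,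
  \<open>R s = |x0| exp (I s)\<close> and \<open>T s = t0 + \<integral>\<^sub>0\<^sup>s R u powr (1 - \<alpha>) du\<close>. By the chain rule, \<open>R s Y s\<close> as a function
  of the time \<open>t = T s\<close> is a nonvanishing solution of the original equation, so by uniqueness and
  maximality it is the given one as long as \<open>t < sup T\<close>, and \<open>sup T \<le> tb\<close>. Defocusing makes \<open>I\<close> grow at
  least linearly, so that \<open>R\<close> and \<open>T\<close> are unbounded. Focusing makes \<open>I\<close> decrease at least linearly; as
  \<open>\<alpha> < 1\<close>, the integrand of \<open>T\<close> decays exponentially, \<open>sup T\<close> is finite and \<open>R\<close> tends to \<open>0\<close> there.\<close>

section \<open>Uniqueness for autonomous equations with a locally Lipschitz field\<close>

text \<open>The derivative of \<open>u s \<bullet> u s\<close> lies between plus and minus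
  \<open>2 * L\<close> times its value. Weighted with \<open>exp (- 2 * L * s)\<close> the square is
  therefore nonincreasing, and weighted with \<open>exp (2 * L * s)\<close> nondecreasing. The first
  carries a zero from \<open>c\<close> to \<open>e\<close>, the second from \<open>e\<close> back to
  \<open>c\<close>.\<close>

lemma gronwall_zero_iff:
  fixes u u' :: "real \<Rightarrow> 'a::real_inner"
  assumes "c \<le> e" and cont: "continuous_on {c..e} u"
    and der: "\<And>s. c < s \<Longrightarrow> s < e \<Longrightarrow> (u has_vector_derivative u' s) (at s)"
    and bnd: "\<And>s. c < s \<Longrightarrow> s < e \<Longrightarrow> \<bar>u s \<bullet> u' s\<bar> \<le> L * (u s \<bullet> u s)"
  shows "u c = 0 \<longleftrightarrow> u e = 0"
proof -
  have D: "((\<lambda>s. exp (k * s) * (u s \<bullet> u s)) has_real_derivative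
      exp (k * s) * (k * (u s \<bullet> u s) + 2 * (u s \<bullet> u' s))) (at s)"
    if "c < s" "s < e" for s k
  proof -
    have "((\<lambda>s. u s \<bullet> u s) has_real_derivative 2 * (u s \<bullet> u' s)) (at s)"
      using bounded_bilinear.has_vector_derivative[OF bounded_bilinear_inner der[OF that] der[OF that]]
      by (simp add: has_real_derivative_iff_has_vector_derivative inner_commute)
    then show ?thesis
      by (auto intro!: derivative_eq_intros simp: algebra_simps)
  qed
  have C: "continuous_on {c..e} (\<lambda>s. exp (k * s) * (u s \<bullet> u s))" for k
    by (intro continuous_intros cont)
  have "exp (- 2 * L * c) * (u c \<bullet> u c) \<ge> exp (- 2 * L * e) * (u e \<bullet> u e)"
  proof (rule DERIV_nonpos_imp_decreasing_open[OF \<open>c \<le> e\<close> _ C])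
    fix s assume "c < s" "s < e"
    then show "\<exists>y. ((\<lambda>s. exp (- 2 * L * s) * (u s \<bullet> u s)) has_real_derivative y) (at s) \<and> y \<le> 0"
      using D[of s "- 2 * L"] bnd[of s]
      by (intro exI conjI) (assumption, auto intro!: mult_nonneg_nonpos simp: abs_le_iff)
  qed
  moreover have "exp (2 * L * c) * (u c \<bullet> u c) \<le> exp (2 * L * e) * (u e \<bullet> u e)"
  proof (rule DERIV_nonneg_imp_increasing_open[OF \<open>c \<le> e\<close> _ C])
    fix s assume "c < s" "s < e"
    then show "\<exists>y. ((\<lambda>s. exp (2 * L * s) * (u s \<bullet> u s)) has_real_derivative y) (at s) \<and> 0 \<le> y"
      using D[of s "2 * L"] bnd[of s]
      by (intro exI conjI) (assumption, auto intro!: mult_nonneg_nonneg simp: abs_le_iff)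
  qed
  ultimately show ?thesis
    by (auto simp: mult_le_0_iff zero_le_mult_iff) (metis inner_gt_zero_iff not_le)+
qed

text \<open>A connectedness argument on the interval: the set of times where the curves agree is
  closed by continuity, and it is open because the Gronwall estimate applies to \<open>x - z\<close>
  as long as both curves stay in one ball on which \<open>f\<close> is Lipschitz.\<close>

lemma autonomous_ode_unique:
  fixes f :: "'a::real_inner \<Rightarrow> 'a" and x z :: "real \<Rightarrow> 'a"
  assumes lip: "\<And>p. p \<in> W \<Longrightarrow> \<exists>d>0. \<exists>L. L-lipschitz_on (ball p d) f"
    and dx: "\<And>t. t \<in> {a..b} \<Longrightarrow> (x has_vector_derivative f (x t)) (at t within {a..b})"
    and dz: "\<And>t. t \<in> {a..b} \<Longrightarrow> (z has_vector_derivative f (z t)) (at t within {a..b})"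
    and xW: "\<And>t. t \<in> {a..b} \<Longrightarrow> x t \<in> W"
    and "x a = z a" and t: "t \<in> {a..b}"
  shows "x t = z t"
proof -
  have cx: "continuous_on {a..b} x" and cz: "continuous_on {a..b} z"
    unfolding continuous_on_eq_continuous_within
    by (auto intro: has_vector_derivative_continuous[OF dx] has_vector_derivative_continuous[OF dz])
  define S where "S = {t \<in> {a..b}. x t = z t}"
  have "S = {t \<in> {a..b}. x t - z t = 0}" by (auto simp: S_def)
  then have "closedin (top_of_set {a..b}) S"
    using continuous_closedin_preimage_constant[OF continuous_on_diff[OF cx cz], of 0] by simp
  moreover have "openin (top_of_set {a..b}) S"
    unfolding openin_euclidean_subtopology_iff
  proof (intro conjI ballI)
    show "S \<subseteq> {a..b}" by (auto simp: S_def)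
    fix \<tau> assume "\<tau> \<in> S"
    then have \<tau>: "\<tau> \<in> {a..b}" and eq: "x \<tau> = z \<tau>" by (auto simp: S_def)
    obtain d L where "d > 0" and L: "L-lipschitz_on (ball (x \<tau>) d) f"
      using lip[OF xW[OF \<tau>]] by blast
    \<comment> \<open>Both curves are kept in the Lipschitz ball around \<open>x \<tau>\<close>;
      \<open>z\<close> is close to its centre because \<open>z \<tau> = x \<tau>\<close>.\<close>
    obtain e1 where "e1 > 0" and e1: "\<And>t. t \<in> {a..b} \<Longrightarrow> dist t \<tau> < e1 \<Longrightarrow> dist (x t) (x \<tau>) < d"
      using cx[unfolded continuous_on_iff, rule_format, OF \<tau> \<open>d > 0\<close>] by blast
    obtain e2 where "e2 > 0" and e2: "\<And>t. t \<in> {a..b} \<Longrightarrow> dist t \<tau> < e2 \<Longrightarrow> dist (z t) (x \<tau>) < d"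
      using cz[unfolded continuous_on_iff, rule_format, OF \<tau> \<open>d > 0\<close>] eq by auto
    \<comment> \<open>An equivalence for ordered endpoints, so that \<open>\<tau>\<close> can serve
      as the left end for later times and as the right end for earlier ones.\<close>
    have iff: "x c = z c \<longleftrightarrow> x e = z e"
      if ce: "c \<le> e" "{c..e} \<subseteq> {a..b}" "\<And>t. t \<in> {c..e} \<Longrightarrow> dist t \<tau> < min e1 e2" for c e
    proof -
      have "x c - z c = 0 \<longleftrightarrow> x e - z e = 0"
      proof (rule gronwall_zero_iff[where u = "\<lambda>t. x t - z t" and u' = "\<lambda>t. f (x t) - f (z t)" and L = L])
        show "c \<le> e" by fact
        show "continuous_on {c..e} (\<lambda>t. x t - z t)"
          using cx cz ce(2) by (intro continuous_intros) (auto intro: continuous_on_subset)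
        fix s assume s: "c < s" "s < e"
        then have "s \<in> {c..e}" by auto
        with ce(2) have sab: "s \<in> {a..b}" by blast
        have "a \<le> c" "e \<le> b" using ce(1,2) by simp_all
        then have "at s within {a..b} = at s" using s by (intro at_within_Icc_at) auto
        then show "((\<lambda>t. x t - z t) has_vector_derivative f (x s) - f (z s)) (at s)"
          using dx[OF sab] dz[OF sab] by (auto intro!: derivative_intros)
        have "norm (f (x s) - f (z s)) \<le> L * norm (x s - z s)"
          using lipschitz_on_normD[OF L] e1[OF sab] e2[OF sab] ce(3)[OF \<open>s \<in> {c..e}\<close>]
          by (simp add: dist_commute)
        then have "norm (x s - z s) * norm (f (x s) - f (z s)) \<le> norm (x s - z s) * (L * norm (x s - z s))"
          by (intro mult_left_mono) auto
        then show "\<bar>(x s - z s) \<bullet> (f (x s) - f (z s))\<bar> \<le> L * ((x s - z s) \<bullet> (x s - z s))"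
          using Cauchy_Schwarz_ineq2[of "x s - z s" "f (x s) - f (z s)"]
          by (simp add: dot_square_norm power2_eq_square mult_ac)
      qed
      then show ?thesis by simp
    qed
    show "\<exists>e>0. \<forall>t\<in>{a..b}. dist t \<tau> < e \<longrightarrow> t \<in> S"
    proof (intro exI[of _ "min e1 e2"] conjI ballI impI)
      show "min e1 e2 > 0" using \<open>e1 > 0\<close> \<open>e2 > 0\<close> by simp
      fix t assume t: "t \<in> {a..b}" "dist t \<tau> < min e1 e2"
      have "x t = z t"
      proof (cases "\<tau> \<le> t")
        case True
        then have "x \<tau> = z \<tau> \<longleftrightarrow> x t = z t"
          using \<tau> t by (intro iff) (auto simp: dist_real_def)
        then show ?thesis using eq by simp
      next
        case False
        then have "x t = z t \<longleftrightarrow> x \<tau> = z \<tau>"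
          using \<tau> t by (intro iff) (auto simp: dist_real_def)
        then show ?thesis using eq by simp
      qed
      then show "t \<in> S" using t by (simp add: S_def)
    qed
  qed
  ultimately have "S = {} \<or> S = {a..b}"
    by (intro connected_Icc[of a b, unfolded connected_clopen, rule_format] conjI)
  moreover have "a \<in> S" using \<open>x a = z a\<close> t by (auto simp: S_def)
  ultimately have "S = {a..b}" by auto
  then have "t \<in> S" using t by simp
  then show ?thesis by (simp add: S_def)
qed

section \<open>Local Lipschitz continuity of the homogeneous field away from the origin\<close>

lemma lipschitz_on_bounded_scaleR:
  fixes g :: "'a::metric_space \<Rightarrow> real" and h :: "'a \<Rightarrow> 'b::real_normed_vector"
  assumes g: "C-lipschitz_on S g" and h: "D-lipschitz_on S h"
    and B: "\<And>x. x \<in> S \<Longrightarrow> \<bar>g x\<bar> \<le> B" and M: "\<And>x. x \<in> S \<Longrightarrow> norm (h x) \<le> M"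
    and "0 \<le> B" "0 \<le> M"
  shows "(B * D + C * M)-lipschitz_on S (\<lambda>x. g x *\<^sub>R h x)"
proof (rule lipschitz_onI)
  have nn: "0 \<le> C" "0 \<le> D" using g h lipschitz_on_nonneg by blast+
  then show "0 \<le> B * D + C * M" using assms by simp
  fix x y assume xy: "x \<in> S" "y \<in> S"
  have "g x *\<^sub>R h x - g y *\<^sub>R h y = g x *\<^sub>R (h x - h y) + (g x - g y) *\<^sub>R h y"
    by (simp add: algebra_simps)
  then have "dist (g x *\<^sub>R h x) (g y *\<^sub>R h y) \<le> \<bar>g x\<bar> * dist (h x) (h y) + dist (g x) (g y) * norm (h y)"
    using norm_triangle_ineq[of "g x *\<^sub>R (h x - h y)" "(g x - g y) *\<^sub>R h y"]
    by (simp add: dist_norm)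
  also have "\<dots> \<le> B * (D * dist x y) + (C * dist x y) * M"
    using xy nn \<open>0 \<le> B\<close> by (intro add_mono mult_mono B M lipschitz_onD[OF g] lipschitz_onD[OF h]) auto
  finally show "dist (g x *\<^sub>R h x) (g y *\<^sub>R h y) \<le> (B * D + C * M) * dist x y"
    by (simp add: algebra_simps)
qed

text \<open>The radius \<open>r/2\<close> keeps the ball away from \<open>0\<close>, so the
  derivative of the power is continuous, hence bounded, on a compact convex set, and the mean value
  inequality applies.\<close>

lemma powr_local_lipschitz:
  fixes r \<alpha> :: real
  assumes "r > 0"
  shows "\<exists>d>0. \<exists>L. L-lipschitz_on (cball r d) (\<lambda>s. s powr \<alpha>)"
proof -
  have pos: "s > 0" if "s \<in> cball r (r/2)" for s
    using that assms by (auto simp: dist_real_def abs_if field_simps split: if_splits)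
  have "continuous_on (cball r (r/2)) (\<lambda>s. \<alpha> * s powr (\<alpha> - 1))"
    using pos by (intro continuous_intros) force
  then have "bounded ((\<lambda>s. \<alpha> * s powr (\<alpha> - 1)) ` cball r (r/2))"
    by (intro compact_imp_bounded compact_continuous_image) auto
  then obtain L where L: "\<And>s. s \<in> cball r (r/2) \<Longrightarrow> \<bar>\<alpha> * s powr (\<alpha> - 1)\<bar> \<le> L"
    unfolding bounded_iff by (auto simp del: mem_cball)
  have "L-lipschitz_on (cball r (r/2)) (\<lambda>s. s powr \<alpha>)"
  proof (rule lipschitz_onI)
    show "0 \<le> L" using L[of r] assms by (auto intro: order_trans[OF abs_ge_zero])
    fix s u assume "s \<in> cball r (r/2)" "u \<in> cball r (r/2)"
    then have "norm (s powr \<alpha> - u powr \<alpha>) \<le> L * norm (s - u)"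
      using pos L
      by (intro field_differentiable_bound[where f = "\<lambda>s. s powr \<alpha>" and f' = "\<lambda>s. \<alpha> * s powr (\<alpha> - 1)"
            and S = "cball r (r/2)"])
         (auto intro!: has_field_derivative_at_within has_real_derivative_powr simp del: mem_cball)
    then show "dist (s powr \<alpha>) (u powr \<alpha>) \<le> L * dist s u" by (simp add: dist_norm)
  qed
  then show ?thesis using assms by (intro exI[of _ "r/2"]) auto
qed

text \<open>The difference of two directions splits into a change of vector and a change of length.
  Each contributes at most \<open>norm (z - w) / norm z\<close>, and
  \<open>norm z \<ge> norm p / 2\<close> on the ball; together this gives the constant
  \<open>4 / norm p\<close>.\<close>

lemma direction_lipschitz:
  fixes p :: "'a::real_normed_vector"
  assumes "p \<noteq> 0"
  shows "(4 / norm p)-lipschitz_on (ball p (norm p / 2)) (\<lambda>z. z /\<^sub>R norm z)"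
proof (rule lipschitz_onI)
  show "0 \<le> 4 / norm p" by simp
  fix z w assume "z \<in> ball p (norm p / 2)" "w \<in> ball p (norm p / 2)"
  then have z: "norm z \<ge> norm p / 2" and w: "norm w \<ge> norm p / 2"
    using norm_triangle_ineq2[of p z] norm_triangle_ineq2[of p w] by (auto simp: dist_norm)
  have pos: "norm p > 0" "norm z > 0" "norm w > 0" using assms z w by (auto simp: field_simps)
  have "z /\<^sub>R norm z - w /\<^sub>R norm w = (z - w) /\<^sub>R norm z + ((norm w - norm z) / (norm z * norm w)) *\<^sub>R w"
  proof -
    have "(norm w - norm z) / (norm z * norm w) = inverse (norm z) - inverse (norm w)"
      using pos by (simp add: field_simps)
    then show ?thesis by (simp add: scaleR_diff_left scaleR_diff_right)
  qed
  then have "norm (z /\<^sub>R norm z - w /\<^sub>R norm w) \<le>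
      norm (z - w) / norm z + \<bar>norm w - norm z\<bar> / (norm z * norm w) * norm w"
    using norm_triangle_ineq[of "(z - w) /\<^sub>R norm z" "((norm w - norm z) / (norm z * norm w)) *\<^sub>R w"]
    by (simp add: divide_inverse abs_mult mult_ac)
  also have "\<dots> = (norm (z - w) + \<bar>norm w - norm z\<bar>) / norm z"
    using pos by (simp add: field_simps)
  also have "\<dots> \<le> (2 * norm (z - w)) / (norm p / 2)"
    using pos z norm_triangle_ineq3[of z w] by (intro frac_le) auto
  finally show "dist (z /\<^sub>R norm z) (w /\<^sub>R norm w) \<le> 4 / norm p * dist z w"
    by (simp add: dist_norm)
qed

lemma C1_on_sphere_continuous_on:
  assumes "C1_on_sphere F"
  shows "continuous_on (sphere 0 1) F"
proof -
  obtain U G G' where "sphere 0 1 \<subseteq> U" "\<forall>p\<in>sphere 0 1. G p = F p"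
    "\<forall>p\<in>U. (G has_derivative blinfun_apply (G' p)) (at p)"
    using assms unfolding C1_on_sphere_def by blast
  then have "continuous_on (sphere 0 1) G"
    by (meson continuous_at_imp_continuous_on has_derivative_continuous subsetD)
  then show ?thesis
    using \<open>\<forall>p\<in>sphere 0 1. G p = F p\<close> by (simp cong: continuous_on_cong_simp)
qed

lemma C1_on_sphere_local_lipschitz:
  fixes F :: "'a::euclidean_space \<Rightarrow> 'a"
  assumes "C1_on_sphere F" and q: "q \<in> sphere 0 1"
  shows "\<exists>d>0. \<exists>L. L-lipschitz_on (cball q d \<inter> sphere 0 1) F"
proof -
  obtain U G and G' :: "'a \<Rightarrow> 'a \<Rightarrow>\<^sub>L 'a" where U: "open U" "sphere 0 1 \<subseteq> U" and GF: "\<forall>p\<in>sphere 0 1. G p = F p"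
    and G': "\<forall>p\<in>U. (G has_derivative blinfun_apply (G' p)) (at p)" "continuous_on U G'"
    using assms unfolding C1_on_sphere_def by blast
  \<comment> \<open>The extension \<open>G\<close> is viewed as a field depending trivially on time,
    the setting in which local Lipschitz continuity of C1 fields is formulated.\<close>
  have "local_lipschitz (UNIV::real set) U (\<lambda>_. G)"
  proof (rule c1_implies_local_lipschitz[where f' = "\<lambda>z. G' (snd z)"])
    show "continuous_on (UNIV \<times> U) (\<lambda>z. G' (snd z))"
      by (rule continuous_on_compose2[OF G'(2)]) (auto intro: continuous_intros)
  qed (use G' U in auto)
  then obtain d L where "d > 0" and L: "L-lipschitz_on (cball q d \<inter> U) G"
    proof (rule local_lipschitzE)
    show "q \<in> U" "(0::real) \<in> UNIV" using q U by blast+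
    fix u L assume "u > 0" and u: "\<And>s. s \<in> cball (0::real) u \<inter> UNIV \<Longrightarrow> L-lipschitz_on (cball q u \<inter> U) G"
    then have "0 \<in> cball (0::real) u \<inter> UNIV" by simp
    from that[OF \<open>u > 0\<close> u[OF this]] show thesis .
  qed
  have "L-lipschitz_on (cball q d \<inter> sphere 0 1) G"
    by (rule lipschitz_on_subset[OF L]) (use U in blast)
  then have "L-lipschitz_on (cball q d \<inter> sphere 0 1) F"
    by (rule lipschitz_on_transform) (use GF in simp)
  then show ?thesis using \<open>d > 0\<close> by blast
qed

lemma homogeneous_field_local_lipschitz:
  fixes F :: "'a::euclidean_space \<Rightarrow> 'a" and \<alpha> :: real
  assumes F: "C1_on_sphere F" and p: "p \<noteq> 0"
  shows "\<exists>d>0. \<exists>L. L-lipschitz_on (ball p d) (\<lambda>z. (norm z powr \<alpha>) *\<^sub>R F (z /\<^sub>R norm z))"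
proof -
  define q where "q = p /\<^sub>R norm p"
  have q: "q \<in> sphere 0 1" using p by (simp add: q_def)
  obtain dF LF where "dF > 0" and LF: "LF-lipschitz_on (cball q dF \<inter> sphere 0 1) F"
    using C1_on_sphere_local_lipschitz[OF F q] by blast
  obtain dr Lr where "dr > 0" and Lr: "Lr-lipschitz_on (cball (norm p) dr) (\<lambda>s. s powr \<alpha>)"
    using powr_local_lipschitz[of "norm p" \<alpha>] p by auto
  \<comment> \<open>The three bounds serve in turn: the direction map is Lipschitz on the ball, the
    norm stays within \<open>dr\<close> of \<open>norm p\<close>, and the constant
    \<open>4 / norm p\<close> sends the ball into the \<open>dF\<close>-neighbourhood of
    \<open>q\<close>.\<close>
  define d where "d = min (norm p / 2) (min dr (dF * norm p / 4))"
  have "d > 0" using p \<open>dF > 0\<close> \<open>dr > 0\<close> by (simp add: d_def)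
  have dir: "(4 / norm p)-lipschitz_on (ball p d) (\<lambda>z. z /\<^sub>R norm z)"
    by (rule lipschitz_on_subset[OF direction_lipschitz[OF p]]) (simp add: d_def subset_ball)
  have nz: "z \<noteq> 0" if "z \<in> ball p d" for z using that p by (auto simp: d_def)
  have img: "(\<lambda>z. z /\<^sub>R norm z) ` ball p d \<subseteq> cball q dF \<inter> sphere 0 1"
  proof clarify
    fix z assume z: "z \<in> ball p d"
    have "dist q (z /\<^sub>R norm z) \<le> 4 / norm p * dist p z"
      using lipschitz_onD[OF dir, of p z] z \<open>d > 0\<close> by (simp add: q_def)
    also have "\<dots> \<le> 4 / norm p * (dF * norm p / 4)"
      using z by (intro mult_left_mono) (auto simp: d_def)
    also have "\<dots> = dF" using p by simp
    finally show "z /\<^sub>R norm z \<in> cball q dF \<inter> sphere 0 1" using nz[OF z] by simp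
  qed
  have h: "(LF * (4 / norm p))-lipschitz_on (ball p d) (\<lambda>z. F (z /\<^sub>R norm z))"
    by (rule lipschitz_on_compose2[OF dir lipschitz_on_subset[OF LF img]])
  have nimg: "norm ` ball p d \<subseteq> cball (norm p) dr"
  proof clarify
    fix z assume "z \<in> ball p d"
    then show "norm z \<in> cball (norm p) dr"
      using norm_triangle_ineq3[of p z] by (auto simp: d_def dist_norm)
  qed
  have "1-lipschitz_on (ball p d) norm"
    by (rule lipschitz_onI) (auto simp: dist_norm norm_triangle_ineq3)
  from lipschitz_on_compose2[OF this lipschitz_on_subset[OF Lr nimg]]
  have g: "Lr-lipschitz_on (ball p d) (\<lambda>z. norm z powr \<alpha>)" by simp
  \<comment> \<open>A Lipschitz map is bounded on a ball; this provides the sup bounds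
    \<open>B\<close> and \<open>M\<close> for the product estimate.\<close>
  have bd: "\<exists>B\<ge>0. \<forall>z\<in>ball p d. norm (k z) \<le> B" if "K-lipschitz_on (ball p d) k"
    for k :: "'a \<Rightarrow> 'b::real_normed_vector" and K
  proof (intro exI[of _ "norm (k p) + K * d"] conjI ballI)
    have "K \<ge> 0" using that lipschitz_on_nonneg by blast
    then show "0 \<le> norm (k p) + K * d" using \<open>d > 0\<close> by simp
    fix z assume z: "z \<in> ball p d"
    have "norm (k z) \<le> norm (k p) + norm (k z - k p)" using norm_triangle_sub by blast
    also have "norm (k z - k p) \<le> K * norm (z - p)"
      using lipschitz_on_normD[OF that z] \<open>d > 0\<close> by simp
    also have "\<dots> \<le> K * d" using z \<open>K \<ge> 0\<close> by (intro mult_left_mono) (auto simp: dist_norm norm_minus_commute)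
    finally show "norm (k z) \<le> norm (k p) + K * d" by simp
  qed
  obtain B where B: "B \<ge> 0" "\<forall>z\<in>ball p d. norm (norm z powr \<alpha>) \<le> B" using bd[OF g] by blast
  obtain M where M: "M \<ge> 0" "\<forall>z\<in>ball p d. norm (F (z /\<^sub>R norm z)) \<le> M" using bd[OF h] by blast
  show ?thesis
  proof (intro exI conjI)
    show "(B * (LF * (4 / norm p)) + Lr * M)-lipschitz_on (ball p d) (\<lambda>z. (norm z powr \<alpha>) *\<^sub>R F (z /\<^sub>R norm z))"
      by (rule lipschitz_on_bounded_scaleR[OF g h]) (use B M in auto)
  qed fact
qed

section \<open>Rescaled trajectories and the change of time\<close>

text \<open>Provides \<open>I\<close> and \<open>T\<close> on the whole line, so that they have
  two-sided derivatives also at \<open>s = 0\<close>, which corresponds to the initial time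
  \<open>t0\<close>.\<close>

lemma continuous_antiderivative:
  fixes f :: "real \<Rightarrow> real"
  assumes "continuous_on UNIV f"
  obtains G where "G 0 = c" "\<And>s. (G has_real_derivative f s) (at s)"
proof -
  obtain H where H: "\<And>s::real. (H has_vector_derivative f s) (at s)"
    using einterval_antiderivative[of "-\<infinity>" "\<infinity>" f] assms
    by (auto simp: continuous_on_eq_continuous_at)
  show thesis
  proof (rule that[of "\<lambda>s. H s - H 0 + c"])
    show "((\<lambda>s. H s - H 0 + c) has_real_derivative f s) (at s)" for s
      using H[of s] by (auto intro!: derivative_eq_intros simp: has_real_derivative_iff_has_vector_derivative)
  qed simp
qed

text \<open>The product rule recombines the radial and tangential parts into
  \<open>R s *\<^sub>R F (Y s)\<close>. Splitting \<open>R\<close> as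
  \<open>R powr (1 - \<alpha>) * R powr \<alpha>\<close> isolates the factor that the change of time
  removes.\<close>

lemma rescaled_trajectory_derivative:
  fixes F :: "'a::euclidean_space \<Rightarrow> 'a" and Y :: "real \<Rightarrow> 'a"
  assumes Y: "renorm_trajectory F Y"
    and R: "(R has_real_derivative R s * radial_part F (Y s)) (at s)" and pos: "R s > 0"
  defines "X \<equiv> \<lambda>s. R s *\<^sub>R Y s"
  shows "(X has_vector_derivative
      (R s powr (1 - \<alpha>)) *\<^sub>R ((norm (X s) powr \<alpha>) *\<^sub>R F (X s /\<^sub>R norm (X s)))) (at s)"
proof -
  have Ys: "norm (Y s) = 1" and dY: "(Y has_vector_derivative spherical_part F (Y s)) (at s)"
    using Y by (auto simp: renorm_trajectory_def)
  have n: "norm (X s) = R s" "X s /\<^sub>R norm (X s) = Y s" using pos Ys by (simp_all add: X_def)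
  have "R s powr (1 - \<alpha>) * R s powr \<alpha> = R s"
    using pos by (simp flip: powr_add)
  then have "(R s powr (1 - \<alpha>)) *\<^sub>R ((norm (X s) powr \<alpha>) *\<^sub>R F (X s /\<^sub>R norm (X s))) = R s *\<^sub>R F (Y s)"
    unfolding n(2) unfolding n(1) by simp
  also have "\<dots> = R s *\<^sub>R spherical_part F (Y s) + (R s * radial_part F (Y s)) *\<^sub>R Y s"
    by (simp add: spherical_part_def algebra_simps)
  finally show ?thesis
    using has_vector_derivative_scaleR[OF R dY] by (simp add: X_def)
qed

lemma has_real_derivative_inv_at:
  fixes T :: "real \<Rightarrow> real"
  assumes dT: "\<And>s. (T has_real_derivative T' s) (at s)" and "inj T" and "T' s \<noteq> 0"
  shows "(inv T has_real_derivative inverse (T' s)) (at (T s))"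
  unfolding has_field_derivative_def
proof (rule has_derivative_inverse_strong[of UNIV s T "inv T" "(*) (T' s)"])
  show "continuous_on UNIV T"
    using dT DERIV_isCont by (blast intro: continuous_at_imp_continuous_on)
  show "(T has_derivative (*) (T' s)) (at s)" using dT by (simp add: has_field_derivative_def)
qed (use \<open>inj T\<close> \<open>T' s \<noteq> 0\<close> in \<open>auto simp: fun_eq_iff\<close>)

lemma strict_mono_IVT:
  fixes T :: "real \<Rightarrow> real"
  assumes T: "strict_mono T" "continuous_on UNIV T" and t: "T m \<le> t" "t < T s"
  obtains u where "u \<ge> m" "T u = t"
proof -
  have "m \<le> s" using t strict_mono_less[OF T(1), of m s] by linarith
  moreover have "continuous_on {m..s} T" using T(2) continuous_on_subset by blast
  ultimately show thesis using IVT'[of T m t s] t that by auto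
qed

text \<open>Reduces questions about \<open>x\<close> to \<open>R\<close>, \<open>Y\<close> and
  \<open>T\<close>. It only shows that \<open>tb\<close> is at least the supremum of
  \<open>T\<close>; equality in the focusing case comes later, from the decay of
  \<open>R\<close>.\<close>

lemma maximal_solution_eq_rescaled_trajectory:
  fixes F :: "'a::euclidean_space \<Rightarrow> 'a"
  assumes F: "C1_on_sphere F" and x0: "x0 \<noteq> 0"
    and max: "maximal_nonvanishing_solution \<alpha> F t0 x0 tb x"
    and Y: "renorm_trajectory F Y" "Y 0 = x0 /\<^sub>R norm x0"
    and R: "\<And>s. (R has_real_derivative R s * radial_part F (Y s)) (at s)" "\<And>s. R s > 0" "R 0 = norm x0"
    and dT: "\<And>s. (T has_real_derivative R s powr (1 - \<alpha>)) (at s)" and "T 0 = t0"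
    and "s \<ge> 0"
  shows "ereal (T s) < tb" and "x (T s) = R s *\<^sub>R Y s"
proof -
  define f where "f = (\<lambda>z. (norm z powr \<alpha>) *\<^sub>R F (z /\<^sub>R norm z))"
  define X where "X = (\<lambda>s. R s *\<^sub>R Y s)"
  define z where "z = X \<circ> inv T"
  define Tmax where "Tmax = (SUP s\<in>{0..}. ereal (T s))"
  have T'pos: "R s powr (1 - \<alpha>) > 0" for s using R(2)[of s] by simp
  have mono: "strict_mono T"
    using DERIV_pos_imp_increasing[of _ _ T] dT T'pos by (metis strict_monoI)
  then have "inj T" by (rule strict_mono_imp_inj_on)
  have contT: "continuous_on UNIV T"
    using dT DERIV_isCont by (blast intro: continuous_at_imp_continuous_on)
  have zT: "z (T s) = X s" for s using \<open>inj T\<close> by (simp add: z_def)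
  have "norm (Y s) = 1" for s
    using Y(1) by (simp add: renorm_trajectory_def)
  then have X0: "X s \<noteq> 0" for s
    using R(2)[of s] by (metis X_def less_irrefl norm_zero scaleR_eq_0_iff zero_neq_one)
  \<comment> \<open>The derivative of \<open>inv T\<close> is the reciprocal of
    \<open>R s powr (1 - \<alpha>)\<close> and cancels that factor in the derivative of
    \<open>X\<close>.\<close>
  have dz: "(z has_vector_derivative f (z (T s))) (at (T s))" for s
  proof -
    have "(X has_vector_derivative (R s powr (1 - \<alpha>)) *\<^sub>R f (X s)) (at (inv T (T s)))"
      using rescaled_trajectory_derivative[OF Y(1) R(1) R(2)] \<open>inj T\<close>
      by (simp add: f_def X_def)
    moreover have "(inv T has_vector_derivative inverse (R s powr (1 - \<alpha>))) (at (T s))"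
      using has_real_derivative_inv_at[OF dT \<open>inj T\<close>] T'pos[of s]
      by (simp add: has_real_derivative_iff_has_vector_derivative)
    ultimately have "(z has_vector_derivative inverse (R s powr (1 - \<alpha>)) *\<^sub>R (R s powr (1 - \<alpha>)) *\<^sub>R f (X s)) (at (T s))"
      unfolding z_def by (rule vector_diff_chain_at[rotated])
    then show ?thesis using T'pos[of s] by (simp add: zT)
  qed
  have lt: "ereal (T s) < Tmax" if "s \<ge> 0" for s
  proof -
    have "ereal (T s) < ereal (T (s + 1))" using mono by (simp add: strict_mono_less)
    also have "\<dots> \<le> Tmax" unfolding Tmax_def using that by (intro SUP_upper) auto
    finally show ?thesis .
  qed
  have ex: "\<exists>s\<ge>0. T s = t" if t: "t0 \<le> t" "ereal t < Tmax" for t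
  proof -
    obtain s where "t < T s" using t(2) unfolding Tmax_def less_SUP_iff by auto
    then obtain u where "u \<ge> 0" "T u = t"
      using strict_mono_IVT[OF mono contT, of 0 t s] t \<open>T 0 = t0\<close> by auto
    then show ?thesis by blast
  qed
  have sol: "nonvanishing_solution \<alpha> F t0 x0 tb x"
    and maxD: "\<And>tb' x'. nonvanishing_solution \<alpha> F t0 x0 tb' x' \<Longrightarrow>
        (\<And>t. t0 \<le> t \<Longrightarrow> ereal t < tb \<Longrightarrow> x' t = x t) \<Longrightarrow> tb' \<le> tb"
    using max unfolding maximal_nonvanishing_solution_def by auto
  have solz: "nonvanishing_solution \<alpha> F t0 x0 Tmax z"
    unfolding nonvanishing_solution_def
  proof (intro conjI allI impI)
    show "ereal t0 < Tmax" using lt[of 0] \<open>T 0 = t0\<close> by simp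
    show "z t0 = x0" using zT[of 0] \<open>T 0 = t0\<close> R(3) Y(2) x0 by (simp add: X_def)
    fix t assume "t0 \<le> t \<and> ereal t < Tmax"
    then obtain u where u: "T u = t" using ex by blast
    show "z t \<noteq> 0" using X0[of u] zT[of u] u by simp
    show "(z has_vector_derivative norm (z t) powr \<alpha> *\<^sub>R F (z t /\<^sub>R norm (z t)))
          (at t within {u. t0 \<le> u \<and> ereal u < Tmax})"
      using dz[of u] u by (simp add: f_def has_vector_derivative_at_within)
  qed
  have agree: "z t = x t" if t: "t0 \<le> t" "ereal t < tb" "ereal t < Tmax" for t
  proof (rule autonomous_ode_unique[where W = "- {0}" and f = f and a = t0 and b = t])
    show "\<exists>d>0. \<exists>L. L-lipschitz_on (ball p d) f" if "p \<in> - {0}" for p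
      using homogeneous_field_local_lipschitz[OF F] that unfolding f_def by simp
    have D: "ereal u < tb" "ereal u < Tmax" if "u \<in> {t0..t}" for u
      using that t by (auto intro: order.strict_trans1[of _ "ereal t"])
    show "(z has_vector_derivative f (z u)) (at u within {t0..t})" if "u \<in> {t0..t}" for u
      by (rule has_vector_derivative_within_subset[of _ _ _ "{u. t0 \<le> u \<and> ereal u < Tmax}"])
         (use solz D that in \<open>auto simp: nonvanishing_solution_def f_def\<close>)
    show "(x has_vector_derivative f (x u)) (at u within {t0..t})" if "u \<in> {t0..t}" for u
      by (rule has_vector_derivative_within_subset[of _ _ _ "{u. t0 \<le> u \<and> ereal u < tb}"])
         (use sol D that in \<open>auto simp: nonvanishing_solution_def f_def\<close>)
    show "z u \<in> - {0}" if "u \<in> {t0..t}" for u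
      using solz D that by (auto simp: nonvanishing_solution_def)
    show "z t0 = x t0" using sol solz by (auto simp: nonvanishing_solution_def)
  qed (use t in auto)
  have "Tmax \<le> tb"
  proof (rule ccontr)
    \<comment> \<open>Otherwise \<open>z\<close> would continue \<open>x\<close> beyond
      \<open>tb\<close>, against maximality.\<close>
    assume "\<not> Tmax \<le> tb"
    then have "z t = x t" if "t0 \<le> t" "ereal t < tb" for t
      using that by (intro agree) auto
    with maxD[OF solz] \<open>\<not> Tmax \<le> tb\<close> show False by blast
  qed
  then show lt_tb: "ereal (T s) < tb" using lt[OF \<open>s \<ge> 0\<close>] by simp
  have "t0 \<le> T s" using mono \<open>s \<ge> 0\<close> \<open>T 0 = t0\<close> by (metis strict_mono_less_eq)
  then show "x (T s) = R s *\<^sub>R Y s"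
    using agree[OF _ lt_tb lt[OF \<open>s \<ge> 0\<close>]] zT[of s] by (simp add: X_def)
qed

section \<open>Passing limits through the change of time\<close>

text \<open>Every \<open>t\<close> close enough to \<open>L\<close> from the left is
  \<open>T s\<close> for some large \<open>s\<close>, by the intermediate value theorem. Hence a
  limit of \<open>g (T s)\<close> as \<open>s\<close> tends to infinity is also the limit of
  \<open>g\<close> at \<open>L\<close> from the left.\<close>

lemma at_left_le_filtermap_at_top:
  fixes T :: "real \<Rightarrow> real"
  assumes T: "strict_mono T" "continuous_on UNIV T"
    and lt: "\<And>s. T s < L" and ex: "\<And>t. t < L \<Longrightarrow> \<exists>s. t < T s"
  shows "at_left L \<le> filtermap T at_top"
proof (rule filter_leI)
  fix P assume "eventually P (filtermap T at_top)"
  then obtain M where M: "\<And>s. s \<ge> M \<Longrightarrow> P (T s)"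
    by (auto simp: eventually_filtermap eventually_at_top_linorder)
  have "P t" if "t > T M" "t < L" for t
  proof -
    obtain s where "t < T s" using ex \<open>t < L\<close> by blast
    then show ?thesis using strict_mono_IVT[OF T, of M t s] M that by (metis less_imp_le)
  qed
  then show "eventually P (at_left L)"
    by (intro eventually_at_leftI[of "T M"] lt) auto
qed

lemma at_top_le_filtermap_at_top:
  fixes T :: "real \<Rightarrow> real"
  assumes T: "strict_mono T" "continuous_on UNIV T" and ex: "\<And>t. \<exists>s. t < T s"
  shows "at_top \<le> filtermap T at_top"
proof (rule filter_leI)
  fix P assume "eventually P (filtermap T at_top)"
  then obtain M where M: "\<And>s. s \<ge> M \<Longrightarrow> P (T s)"
    by (auto simp: eventually_filtermap eventually_at_top_linorder)
  have "P t" if "t > T M" for t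
  proof -
    obtain s where "t < T s" using ex by blast
    then show ?thesis using strict_mono_IVT[OF T, of M t s] M that by (metis less_imp_le)
  qed
  then show "eventually P at_top" by (auto simp: eventually_at_top_dense)
qed

section \<open>Linear bounds on the integrated radial part\<close>

lemma radial_mean_eq:
  assumes "\<And>s. (I has_real_derivative radial_part F (Y s)) (at s)" and "I 0 = 0" and "s > 0"
  shows "radial_mean F Y s = I s / s"
proof -
  have "((\<lambda>s'. radial_part F (Y s')) has_integral I s - I 0) {0..s}"
    using assms by (intro fundamental_theorem_of_calculus)
      (auto simp: has_real_derivative_iff_has_vector_derivative[symmetric] intro: has_field_derivative_at_within)
  then show ?thesis using assms by (simp add: radial_mean_def integral_unique)
qed

text \<open>The strict inequality leaves room for a real \<open>c\<close> between \<open>0\<close>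
  and the lower limit; eventually the mean exceeds \<open>c\<close>, and multiplying by
  \<open>s\<close> gives the bound.\<close>

lemma lower_radial_mean_posD:
  assumes I: "\<And>s. (I has_real_derivative radial_part F (Y s)) (at s)" "I 0 = 0"
    and "0 < lower_radial_mean F Y"
  obtains c S where "c > 0" "S > 0" "\<And>s. s \<ge> S \<Longrightarrow> c * s \<le> I s"
proof -
  obtain c where c: "0 < ereal c" "ereal c < lower_radial_mean F Y"
    using ereal_dense2 assms(3) by blast
  then have "eventually (\<lambda>s. ereal c < ereal (radial_mean F Y s)) at_top"
    unfolding lower_radial_mean_def by (intro less_LiminfD)
  then obtain S where S: "\<And>s. s \<ge> S \<Longrightarrow> c < radial_mean F Y s"
    by (auto simp: eventually_at_top_linorder)
  show thesis
  \<comment> \<open>The \<open>1\<close> keeps \<open>s\<close> positive, so that the mean really is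
    \<open>I s / s\<close>.\<close>
  proof (rule that[of c "max S 1"])
    fix s assume "s \<ge> max S 1"
    then show "c * s \<le> I s" using S[of s] radial_mean_eq[OF I, of s] by (simp add: field_simps)
  qed (use c in auto)
qed

lemma upper_radial_mean_negD:
  assumes I: "\<And>s. (I has_real_derivative radial_part F (Y s)) (at s)" "I 0 = 0"
    and "upper_radial_mean F Y < 0"
  obtains c S where "c > 0" "S > 0" "\<And>s. s \<ge> S \<Longrightarrow> I s \<le> - c * s"
proof -
  obtain c where c: "upper_radial_mean F Y < ereal c" "ereal c < 0"
    using ereal_dense2 assms(3) by blast
  then have "eventually (\<lambda>s. ereal (radial_mean F Y s) < ereal c) at_top"
    unfolding upper_radial_mean_def by (intro Limsup_lessD)
  then obtain S where S: "\<And>s. s \<ge> S \<Longrightarrow> radial_mean F Y s < c"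
    by (auto simp: eventually_at_top_linorder)
  show thesis
  \<comment> \<open>Here \<open>c\<close> is negative, so the decay rate is
    \<open>- c\<close>.\<close>
  proof (rule that[of "- c" "max S 1"])
    fix s assume "s \<ge> max S 1"
    then show "I s \<le> - (- c) * s" using S[of s] radial_mean_eq[OF I, of s] by (simp add: field_simps)
  qed (use c in auto)
qed

section \<open>Growth and collapse along a trajectory in the basin\<close>

theorem theorem1:
  fixes F :: "'a::euclidean_space \<Rightarrow> 'a" and A :: "'a set"
    and \<alpha> t0 :: real and tb :: ereal and x0 :: 'a and x :: "real \<Rightarrow> 'a"
  assumes "\<alpha> < 1"
    and "C1_on_sphere F"
    and "x0 \<noteq> 0"
    and "maximal_nonvanishing_solution \<alpha> F t0 x0 tb x"
    and "attractor F A"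
  shows "(defocusing F A \<and> x0 /\<^sub>R norm x0 \<in> basin F A \<longrightarrow>
            tb = \<infinity> \<and> filterlim (\<lambda>t. norm (x t)) at_top at_top) \<and>
         (focusing F A \<and> x0 /\<^sub>R norm x0 \<in> basin F A \<longrightarrow>
            (\<exists>T. tb = ereal T \<and>
               ((\<lambda>t. norm (x t)) \<longlongrightarrow> 0) (at_left T) \<and>
               ((\<lambda>t. infdist (x t /\<^sub>R norm (x t)) A) \<longlongrightarrow> 0) (at_left T)))"
proof (cases "x0 /\<^sub>R norm x0 \<in> basin F A")
  case False
  then show ?thesis by simp
next
  case True
  \<comment> \<open>The basin yields a trajectory through the initial direction that is defined for
    all real \<open>s\<close> and approaches \<open>A\<close>; this approach is the source of the
    distance claim in the focusing case.\<close>
  then obtain Y where Y: "renorm_trajectory F Y" "Y 0 = x0 /\<^sub>R norm x0"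
    and Y_lim: "((\<lambda>s. infdist (Y s) A) \<longlongrightarrow> 0) at_top"
    unfolding basin_def by auto
  have Ysph: "Y s \<in> sphere 0 1" and "isCont Y s" for s
    using Y(1) has_vector_derivative_continuous[of Y] unfolding renorm_trajectory_def by blast+
  then have contY: "continuous_on UNIV Y" by (simp add: continuous_at_imp_continuous_on)
  have "continuous_on UNIV (\<lambda>s. radial_part F (Y s))"
    unfolding radial_part_def using Ysph contY
    by (intro continuous_intros continuous_on_compose2[OF C1_on_sphere_continuous_on[OF \<open>C1_on_sphere F\<close>]]) auto
  from continuous_antiderivative[OF this, where c = 0]
  obtain I where I: "\<And>s. (I has_real_derivative radial_part F (Y s)) (at s)" "I 0 = 0" by metis
  define R where "R = (\<lambda>s. norm x0 * exp (I s))"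
  have dR: "(R has_real_derivative R s * radial_part F (Y s)) (at s)" for s
    unfolding R_def by (auto intro!: derivative_eq_intros I)
  have Rpos: "R s > 0" for s using \<open>x0 \<noteq> 0\<close> by (simp add: R_def)
  have R0: "R 0 = norm x0" using I by (simp add: R_def)
  have "continuous_on UNIV R"
    using dR DERIV_isCont by (blast intro: continuous_at_imp_continuous_on)
  then have "continuous_on UNIV (\<lambda>s. R s powr (1 - \<alpha>))"
    using Rpos by (intro continuous_intros) (auto simp: less_imp_neq[symmetric])
  from continuous_antiderivative[OF this, where c = t0]
  obtain T where dT: "\<And>s. (T has_real_derivative R s powr (1 - \<alpha>)) (at s)" and T0: "T 0 = t0" by metis
  have "R s powr (1 - \<alpha>) > 0" for s using Rpos[of s] by simp
  then have mono: "strict_mono T"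
    using DERIV_pos_imp_increasing[of _ _ T] dT by (metis strict_monoI)
  have contT: "continuous_on UNIV T"
    using dT DERIV_isCont by (blast intro: continuous_at_imp_continuous_on)
  note eq = maximal_solution_eq_rescaled_trajectory[OF assms(2-4) Y dR Rpos R0 dT T0]
  have norm_xT: "norm (x (T s)) = R s" if "s \<ge> 0" for s
    using eq(2)[OF that] Ysph[of s] Rpos[of s] by simp
  define K where "K = norm x0 powr (1 - \<alpha>)"
  have "K > 0" using \<open>x0 \<noteq> 0\<close> by (simp add: K_def)
  \<comment> \<open>Expresses the derivative of \<open>T\<close> through \<open>I\<close>, so that
    linear bounds on \<open>I\<close> become bounds on the speed of \<open>T\<close>.\<close>
  have T'_eq: "R s powr (1 - \<alpha>) = K * exp ((1 - \<alpha>) * I s)" for s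
    by (simp add: R_def K_def powr_mult exp_powr_real mult.commute)
  have "tb = \<infinity> \<and> filterlim (\<lambda>t. norm (x t)) at_top at_top" if "defocusing F A"
  proof -
    have "0 < lower_radial_mean F Y"
      using that Y True by (auto simp: defocusing_def)
    from lower_radial_mean_posD[OF I this]
    obtain c S where cS: "c > 0" "S > 0" and Ic: "\<And>s. s \<ge> S \<Longrightarrow> c * s \<le> I s" by metis
    \<comment> \<open>From \<open>S\<close> on \<open>I\<close> is nonnegative, so, as
      \<open>\<alpha> < 1\<close>, the derivative of \<open>T\<close> is at least
      \<open>K\<close>.\<close>
    have T_lower: "T S - K * S \<le> T s - K * s" if "S \<le> s" for s
    proof (rule DERIV_nonneg_imp_nondecreasing[OF that])
      fix u assume u: "S \<le> u" "u \<le> s"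
      then have "0 \<le> c * u" using cS by simp
      with Ic[of u] u have "0 \<le> I u" by linarith
      then have "K * 1 \<le> K * exp ((1 - \<alpha>) * I u)"
        using \<open>K > 0\<close> \<open>\<alpha> < 1\<close> by (intro mult_left_mono) auto
      then show "\<exists>y. ((\<lambda>s. T s - K * s) has_real_derivative y) (at u) \<and> 0 \<le> y"
        by (intro exI[of _ "R u powr (1 - \<alpha>) - K"] conjI)
          (auto intro!: derivative_eq_intros dT simp: T'_eq)
    qed
    have unbounded: "\<exists>s\<ge>0. t < T s" for t
    proof -
      \<comment> \<open>Chosen past \<open>S\<close> and so large that the lower bound
        \<open>T S + K * (s - S)\<close> exceeds \<open>t\<close>; the \<open>1\<close> gives
        strictness.\<close>
      define s where "s = max S ((t - T S) / K + S + 1)"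
      have "(t - T S) / K < s - S" by (simp add: s_def)
      then have "t - T S < K * (s - S)" using \<open>K > 0\<close> by (simp add: field_simps)
      then have "t < T s" using T_lower[of s] by (simp add: s_def algebra_simps)
      moreover have "s \<ge> 0" using cS by (simp add: s_def)
      ultimately show ?thesis by blast
    qed
    have "tb = \<infinity>"
    proof (rule ereal_top)
      fix t
      obtain s where "s \<ge> 0" "t < T s" using unbounded by blast
      then have "ereal t < ereal (T s)" by simp
      also have "\<dots> < tb" by (rule eq(1)) fact
      finally show "ereal t \<le> tb" by simp
    qed
    moreover have "filterlim (\<lambda>s. norm (x (T s))) at_top at_top"
    proof (rule filterlim_at_top_mono)
      show "filterlim (\<lambda>s. norm x0 * exp (c * s)) at_top at_top"
        using \<open>x0 \<noteq> 0\<close> cS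
        by (intro filterlim_tendsto_pos_mult_at_top[OF tendsto_const] filterlim_compose[OF exp_at_top]
            filterlim_ident) auto
      show "\<forall>\<^sub>F s in at_top. norm x0 * exp (c * s) \<le> norm (x (T s))"
        using eventually_ge_at_top[of S] eventually_ge_at_top[of 0]
        by eventually_elim (simp add: norm_xT R_def Ic mult_left_mono)
    qed
    then have "filterlim (\<lambda>t. norm (x t)) at_top (filtermap T at_top)"
      by (simp add: filterlim_filtermap)
    then have "filterlim (\<lambda>t. norm (x t)) at_top at_top"
    proof (rule filterlim_mono[OF _ order_refl])
      show "at_top \<le> filtermap T at_top"
        by (rule at_top_le_filtermap_at_top[OF mono contT]) (use unbounded in blast)
    qed
    ultimately show ?thesis by blast
  qed
  moreover have "\<exists>L. tb = ereal L \<and> ((\<lambda>t. norm (x t)) \<longlongrightarrow> 0) (at_left L) \<and>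
      ((\<lambda>t. infdist (x t /\<^sub>R norm (x t)) A) \<longlongrightarrow> 0) (at_left L)" if "focusing F A"
  proof -
    have "upper_radial_mean F Y < 0"
      using that Y True by (auto simp: focusing_def)
    from upper_radial_mean_negD[OF I this]
    obtain c S where cS: "c > 0" "S > 0" and Ic: "\<And>s. s \<ge> S \<Longrightarrow> I s \<le> - c * s" by metis
    define k where "k = (1 - \<alpha>) * c"
    have "k > 0" using cS \<open>\<alpha> < 1\<close> by (simp add: k_def)
    \<comment> \<open>The added term is the integral of \<open>K * exp (- k * u)\<close> over
      \<open>u\<close> from \<open>s\<close> to infinity. That integrand dominates the derivative of
      \<open>T\<close> from \<open>S\<close> on, so \<open>V\<close> is nonincreasing there and
      \<open>V S\<close> bounds \<open>T\<close>.\<close>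
    define V where "V = (\<lambda>s. T s + K / k * exp (- k * s))"
    have TV: "T s < V s" for s using \<open>K > 0\<close> \<open>k > 0\<close> by (simp add: V_def)
    have V_decr: "V s \<le> V S" if "S \<le> s" for s
    proof (rule DERIV_nonpos_imp_nonincreasing[OF that])
      fix u assume u: "S \<le> u" "u \<le> s"
      have "(1 - \<alpha>) * I u \<le> (1 - \<alpha>) * (- c * u)"
        using \<open>\<alpha> < 1\<close> Ic[OF u(1)] by (intro mult_left_mono) auto
      then have "K * exp ((1 - \<alpha>) * I u) \<le> K * exp (- k * u)"
        using \<open>K > 0\<close> by (simp add: k_def mult_ac)
      then show "\<exists>y. (V has_real_derivative y) (at u) \<and> y \<le> 0"
        using \<open>k > 0\<close> unfolding V_def
        by (intro exI[of _ "R u powr (1 - \<alpha>) - K * exp (- k * u)"] conjI)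
          (auto intro!: derivative_eq_intros dT simp: T'_eq)
    qed
    have T_bound: "T s \<le> V S" for s
    proof (cases "S \<le> s")
      case True
      then show ?thesis using TV[of s] V_decr by fastforce
    next
      case False
      then have "T s < T S" using mono by (simp add: strict_mono_less)
      then show ?thesis using TV[of S] by simp
    qed
    then have bdd: "bdd_above (range T)" by (intro bdd_aboveI[of _ "V S"]) auto
    \<comment> \<open>The blow-up time: the limit of \<open>T s\<close>, approached but never
      attained.\<close>
    define L where "L = (SUP s. T s)"
    have T_less: "T s < L" for s
    proof -
      have "T s < T (s + 1)" using mono by (simp add: strict_mono_less)
      also have "\<dots> \<le> L" unfolding L_def using bdd by (intro cSUP_upper) auto
      finally show ?thesis .
    qed
    have ex: "\<exists>s. t < T s" if "t < L" for t
      using that bdd unfolding L_def by (subst (asm) less_cSUP_iff) auto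
    note le = at_left_le_filtermap_at_top[OF mono contT T_less ex]
    have "((\<lambda>s. norm (x (T s))) \<longlongrightarrow> 0) at_top"
    proof (rule tendsto_sandwich[OF _ _ tendsto_const])
      have "filterlim (\<lambda>s. - c * s) at_bot at_top"
        using cS by (intro filterlim_tendsto_neg_mult_at_bot[OF tendsto_const] filterlim_ident) auto
      then show "((\<lambda>s. norm x0 * exp (- c * s)) \<longlongrightarrow> 0) at_top"
        by (intro tendsto_mult_right_zero filterlim_compose[OF exp_at_bot])
      show "\<forall>\<^sub>F s in at_top. norm (x (T s)) \<le> norm x0 * exp (- c * s)"
        using eventually_ge_at_top[of S] eventually_ge_at_top[of 0]
      proof eventually_elim
        case (elim s)
        then show ?case using Ic[of s] by (simp add: norm_xT R_def mult_left_mono)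
      qed
    qed simp
    then have lim_norm: "((\<lambda>t. norm (x t)) \<longlongrightarrow> 0) (at_left L)"
      by (intro filterlim_mono[OF _ order_refl le]) (simp add: filterlim_filtermap)
    have "((\<lambda>s. infdist (x (T s) /\<^sub>R norm (x (T s))) A) \<longlongrightarrow> 0) at_top"
    proof (rule Lim_transform_eventually[OF Y_lim])
      show "\<forall>\<^sub>F s in at_top. infdist (Y s) A = infdist (x (T s) /\<^sub>R norm (x (T s))) A"
        using eventually_ge_at_top[of 0]
      proof eventually_elim
        case (elim s)
        have "x (T s) /\<^sub>R norm (x (T s)) = Y s"
          using eq(2)[OF elim] Ysph[of s] Rpos[of s] by simp
        then show ?case by simp
      qed
    qed
    then have lim_dist: "((\<lambda>t. infdist (x t /\<^sub>R norm (x t)) A) \<longlongrightarrow> 0) (at_left L)"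
      by (intro filterlim_mono[OF _ order_refl le]) (simp add: filterlim_filtermap)
    have sol: "nonvanishing_solution \<alpha> F t0 x0 tb x"
      using assms(4) by (simp add: maximal_nonvanishing_solution_def)
    have "t0 < L" using T_less[of 0] T0 by simp
    \<comment> \<open>If the solution lived past \<open>L\<close>, it would be continuous at
      \<open>L\<close>, and the limit \<open>0\<close> of its norm would force
      \<open>x L = 0\<close>.\<close>
    have "\<not> ereal L < tb"
    proof
      assume L: "ereal L < tb"
      then have "{t0..L} \<subseteq> {u. t0 \<le> u \<and> ereal u < tb}"
        by (auto intro: order.strict_trans1[of _ "ereal L"])
      moreover have "continuous (at L within {u. t0 \<le> u \<and> ereal u < tb}) x"
        using sol L \<open>t0 < L\<close> has_vector_derivative_continuous
        unfolding nonvanishing_solution_def by (metis less_imp_le)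
      ultimately have "continuous (at L within {t0..L}) x"
        using continuous_within_subset by blast
      then have "(x \<longlongrightarrow> x L) (at_left L)"
        using \<open>t0 < L\<close> by (simp add: continuous_within at_within_Icc_at_left)
      then have "norm (x L) = 0"
        using lim_norm tendsto_norm tendsto_unique trivial_limit_at_left_real by blast
      moreover have "x L \<noteq> 0"
        using sol L \<open>t0 < L\<close> by (auto simp: nonvanishing_solution_def)
      ultimately show False by simp
    qed
    moreover have "\<not> tb < ereal L"
    proof
      assume less: "tb < ereal L"
      moreover have "ereal t0 < tb" using sol by (simp add: nonvanishing_solution_def)
      ultimately obtain b where b: "tb = ereal b" by (cases tb) auto
      then obtain s where s: "b < T s" using ex less by auto
      \<comment> \<open>The bound \<open>T s < tb\<close> is available for nonnegative
        \<open>s\<close>, so \<open>s\<close> is first raised to \<open>max s 0\<close>.\<close>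
      have "T s \<le> T (max s 0)" using mono by (simp add: strict_mono_less_eq)
      also have "\<dots> < b" using eq(1)[of "max s 0"] b by simp
      finally show False using s by simp
    qed
    ultimately have "tb = ereal L" by (simp add: antisym_conv3)
    then show ?thesis using lim_norm lim_dist by blast
  qed
  ultimately show ?thesis by blast
qed

end
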